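(* Let $\nu$ be a lattice path from $(0,0)$ to $(b,a)$. For every $i\ge 0$, the number of $i$-dimensional faces of the $\nu$-associahedron $A_\nu$ equals $\mathtt{sch}_\nu(i)$, the number of $\nu$-Schröder paths with exactly $i$ diagonal steps; therefore the $\nu$-Schröder numbers $\mathtt{sch}_\nu(i)$ enumerate the faces of the $\nu$-associahedron.
   Context: A lattice path from $(0,0)$ to $(b,a)\in\mathbb{Z}_{\ge0}^2$ is a sequence of $a$ north steps $N=(0,1)$ and $b$ east steps $E=(1,0)$. A $\nu$-Schröder path is a path from $(0,0)$ to $(b,a)$ with steps $N$, $E$, $D=(1,1)$ (diagonal) which stays weakly above $\nu$. The $\nu$-associahedron. Let $n=a+b+2$ and let $I\sqcup\overline J=[n]$ be the partition with $1\in I$, $n\in\overline J$, and for $2\le k\le n-1$, $k\in I$ if the $(k-1)$-st step of $\nu$ is $E$ and $k\in\overline J$ if it is $N$. An $(I,\overline J)$-forest is a subgraph of the complete bipartite graph with parts $I$ and $\overline J$ that is increasing (each arc $(i,\overline j)$, $i\in I$, $\overline j\in\overline J$, has $i<\overline j$) and non-crossing (no two arcs $(i,\overline j)$, $(i',\overline j')$ with $i<i'<\overline j<\overline j'$). A covering $(I,\overline J)$-forest is one containing the arc $(1,n)$ and with no isolated nodes. The poset of covering $(I,\overline J)$-forests is ordered by $T\le T'$ iff the arcs of $T'$ are a subset of the arcs of $T$. The face poset of a polyhedral complex is the poset of its non-empty faces ordered by inclusion. The $\nu$-associahedron $A_\nu$ is the polyhedral complex (whose cells are convex polytopes) whose face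 poset is the poset of covering $(I,\overline J)$-forests. *)

theory Defs
  imports "HOL-Analysis.Analysis"
begin

section \<open>Lattice paths and Schroeder paths\<close>

datatype step = North | East | Diag

fun step_vec :: "step \<Rightarrow> real \<times> real" where
  "step_vec North = (0, 1)"
| "step_vec East = (1, 0)"
| "step_vec Diag = (1, 1)"

definition lattice_path :: "nat \<Rightarrow> nat \<Rightarrow> step list \<Rightarrow> bool" where
  "lattice_path b a \<nu> \<longleftrightarrow>
     set \<nu> \<subseteq> {North, East} \<and> count_list \<nu> North = a \<and> count_list \<nu> East = b"

fun path_trace :: "real \<times> real \<Rightarrow> step list \<Rightarrow> (real \<times> real) set" where
  "path_trace p [] = {p}"
| "path_trace p (s # ss) =
     closed_segment p (p + step_vec s) \<union> path_trace (p + step_vec s) ss"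

text \<open>All points of the polygonal curves are compared, not only the vertices: the diagonal
  step from \<open>(0, 0)\<close> to \<open>(1, 1)\<close> runs below the path \<open>[North, East]\<close>, although both
  of its end points lie on that path. The existential quantifier over \<open>y'\<close> compares with
  the lowest point of \<open>\<nu>\<close> on the vertical line at \<open>x\<close>, so that \<open>\<nu>\<close> is
  weakly above itself.\<close>

definition weakly_above :: "step list \<Rightarrow> step list \<Rightarrow> bool" where
  "weakly_above \<pi> \<nu> \<longleftrightarrow>
     (\<forall>(x, y) \<in> path_trace (0, 0) \<pi>. \<exists>y'. (x, y') \<in> path_trace (0, 0) \<nu> \<and> y' \<le> y)"

definition schroeder_path :: "nat \<Rightarrow> nat \<Rightarrow> step list \<Rightarrow> step list \<Rightarrow> bool" where
  "schroeder_path b a \<nu> \<pi> \<longleftrightarrow>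
     sum_list (map step_vec \<pi>) = (real b, real a) \<and> weakly_above \<pi> \<nu>"

definition sch :: "step list \<Rightarrow> nat \<Rightarrow> nat" where
  "sch \<nu> i =
     card {\<pi>. schroeder_path (count_list \<nu> East) (count_list \<nu> North) \<nu> \<pi> \<and>
              count_list \<pi> Diag = i}"


section \<open>Covering forests\<close>

definition num_nodes :: "step list \<Rightarrow> nat" where
  "num_nodes \<nu> = length \<nu> + 2"

text \<open>Node \<open>k\<close> with \<open>2 \<le> k \<le> n - 1\<close> belongs to the \<open>(k - 1)\<close>-st step of
  \<open>\<nu>\<close>, which is \<open>\<nu> ! (k - 2)\<close> since list positions start at 0.\<close>

definition I_nodes :: "step list \<Rightarrow> nat set" where
  "I_nodes \<nu> = {1} \<union> {k. 2 \<le> k \<and> k \<le> num_nodes \<nu> - 1 \<and> \<nu> ! (k - 2) = East}"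

definition J_nodes :: "step list \<Rightarrow> nat set" where
  "J_nodes \<nu> = {num_nodes \<nu>} \<union>
     {k. 2 \<le> k \<and> k \<le> num_nodes \<nu> - 1 \<and> \<nu> ! (k - 2) = North}"

text \<open>A forest is given by its set of arcs; its nodes are always all of
  \<open>{1..num_nodes \<nu>}\<close>. Acyclicity is not demanded: the conditions imply it.\<close>

definition IJ_forest :: "step list \<Rightarrow> (nat \<times> nat) set \<Rightarrow> bool" where
  "IJ_forest \<nu> T \<longleftrightarrow>
     T \<subseteq> I_nodes \<nu> \<times> J_nodes \<nu> \<and>
     (\<forall>(i, j) \<in> T. i < j) \<and>
     \<not> (\<exists>i j i' j'. (i, j) \<in> T \<and> (i', j') \<in> T \<and> i < i' \<and> i' < j \<and> j < j')"

definition covering_forest :: "step list \<Rightarrow> (nat \<times> nat) set \<Rightarrow> bool" where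
  "covering_forest \<nu> T \<longleftrightarrow>
     IJ_forest \<nu> T \<and> (1, num_nodes \<nu>) \<in> T \<and>
     (\<forall>k \<in> {1..num_nodes \<nu>}. \<exists>(i, j) \<in> T. k = i \<or> k = j)"


section \<open>Polyhedral complexes and the associahedron\<close>

definition polyhedral_complex :: "'a::euclidean_space set set \<Rightarrow> bool" where
  "polyhedral_complex K \<longleftrightarrow>
     finite K \<and>
     (\<forall>C \<in> K. polytope C) \<and>
     (\<forall>C F. C \<in> K \<and> F face_of C \<longrightarrow> F \<in> K) \<and>
     (\<forall>C C'. C \<in> K \<and> C' \<in> K \<longrightarrow> (C \<inter> C') face_of C \<and> (C \<inter> C') face_of C')"

text \<open>The empty set is a face of every convex set in the sense of \<open>face_of\<close>.\<close>

definition nonempty_faces :: "'a::euclidean_space set set \<Rightarrow> 'a set set" where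
  "nonempty_faces K = K - {{}}"

text \<open>The face poset determines the complex only up to combinatorial equivalence, so being
  the \<open>\<nu>\<close>-associahedron is a property of a complex \<open>K\<close>. The order on forests is
  reversed inclusion of arc sets.\<close>

definition nu_associahedron :: "step list \<Rightarrow> 'a::euclidean_space set set \<Rightarrow> bool" where
  "nu_associahedron \<nu> K \<longleftrightarrow>
     polyhedral_complex K \<and>
     (\<exists>\<phi>. bij_betw \<phi> (nonempty_faces K) {T. covering_forest \<nu> T} \<and>
          (\<forall>F \<in> nonempty_faces K. \<forall>G \<in> nonempty_faces K. F \<subseteq> G \<longleftrightarrow> \<phi> G \<subseteq> \<phi> F))"

end

theory Submission
  imports Defs
begin

text \<open>In a polytope every nonempty face of positive dimension has a facet, and every covering forest
  with fewer than \<open>length \<nu> + 1\<close> arcs is contained in one with exactly one more arc; hence a face \<open>F\<close>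
  corresponds to a forest with \<open>length \<nu> + 1 - dim F\<close> arcs. As a Schroeder path with \<open>i\<close> diagonal steps
  has \<open>length \<nu> - i\<close> steps, it remains to match forests with \<open>k + 1\<close> arcs and paths with \<open>k\<close> steps. If
  \<open>\<nu>\<close> begins with \<open>E^(e+1) N\<close>, the two adjacent nodes \<open>E\<close> and \<open>N\<close> are joined and at least one of
  them is a leaf; deleting the arc and the leaves leaves a forest for \<open>\<nu>\<close> with this \<open>E\<close>, this \<open>N\<close>,
  or both removed. The paths satisfy the same recursion by their first step \<open>N\<close> (remove \<open>N\<close>),
  \<open>E\<close> (remove \<open>E\<close>) or \<open>D\<close> (remove both).\<close>

section \<open>Covering forests on abstract node sets\<close>

text \<open>The node sets are arbitrary, so that nodes can be deleted without renumbering the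
  others; \<open>lo\<close> and \<open>hi\<close> stand for the nodes 1 and n. Covering is split
  into left ends (\<open>Domain\<close>) and right ends (\<open>Range\<close>).\<close>

definition forests :: "nat \<Rightarrow> nat \<Rightarrow> nat set \<Rightarrow> nat set \<Rightarrow> (nat \<times> nat) set set" where
  "forests lo hi I J =
     {T. T \<subseteq> I \<times> J \<and> (\<forall>(i, j) \<in> T. i < j) \<and>
         (\<forall>i j i' j'. (i, j) \<in> T \<longrightarrow> (i', j') \<in> T \<longrightarrow> \<not> (i < i' \<and> i' < j \<and> j < j')) \<and>
         (lo, hi) \<in> T \<and> I \<subseteq> Domain T \<and> J \<subseteq> Range T}"

lemma forestsI:
  assumes "\<And>i j. (i, j) \<in> T \<Longrightarrow> i \<in> I \<and> j \<in> J \<and> i < j"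
    and "\<And>i j i' j'. (i, j) \<in> T \<Longrightarrow> (i', j') \<in> T \<Longrightarrow> i < i' \<Longrightarrow> i' < j \<Longrightarrow> j < j' \<Longrightarrow> False"
    and "(lo, hi) \<in> T"
    and "\<And>i. i \<in> I \<Longrightarrow> \<exists>j. (i, j) \<in> T"
    and "\<And>j. j \<in> J \<Longrightarrow> \<exists>i. (i, j) \<in> T"
  shows "T \<in> forests lo hi I J"
proof -
  have "I \<subseteq> Domain T" "J \<subseteq> Range T" using assms(4,5) by blast+
  moreover have "T \<subseteq> I \<times> J" "\<forall>(i, j) \<in> T. i < j" using assms(1) by auto
  ultimately show ?thesis using assms(2,3) unfolding forests_def by blast
qed

lemma forestsD:
  assumes "T \<in> forests lo hi I J"
  shows "\<And>i j. (i, j) \<in> T \<Longrightarrow> i \<in> I \<and> j \<in> J \<and> i < j"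
    and "\<And>i j i' j'. (i, j) \<in> T \<Longrightarrow> (i', j') \<in> T \<Longrightarrow> i < i' \<Longrightarrow> i' < j \<Longrightarrow> j < j' \<Longrightarrow> False"
    and "(lo, hi) \<in> T"
    and "\<And>i. i \<in> I \<Longrightarrow> \<exists>j. (i, j) \<in> T"
    and "\<And>j. j \<in> J \<Longrightarrow> \<exists>i. (i, j) \<in> T"
proof -
  have T: "T \<subseteq> I \<times> J" "\<forall>(i, j) \<in> T. i < j"
    "\<forall>i j i' j'. (i, j) \<in> T \<longrightarrow> (i', j') \<in> T \<longrightarrow> \<not> (i < i' \<and> i' < j \<and> j < j')"
    "(lo, hi) \<in> T" "I \<subseteq> Domain T" "J \<subseteq> Range T"
    using assms by (simp_all add: forests_def)
  show "\<And>i j. (i, j) \<in> T \<Longrightarrow> i \<in> I \<and> j \<in> J \<and> i < j" using T(1,2) by auto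
  show "\<And>i j i' j'. (i, j) \<in> T \<Longrightarrow> (i', j') \<in> T \<Longrightarrow> i < i' \<Longrightarrow> i' < j \<Longrightarrow> j < j' \<Longrightarrow> False"
    using T(3) by blast
  show "(lo, hi) \<in> T" by fact
  show "\<And>i. i \<in> I \<Longrightarrow> \<exists>j. (i, j) \<in> T" using T(5) by blast
  show "\<And>j. j \<in> J \<Longrightarrow> \<exists>i. (i, j) \<in> T" using T(6) by blast
qed

text \<open>Deleting arcs can only destroy the covering condition, which is repaired by shrinking
  the node sets to the ends of the remaining arcs.\<close>

lemma forests_subset:
  assumes T: "T \<in> forests lo hi I J" and "S \<subseteq> T" "(lo, hi) \<in> S"
  shows "S \<in> forests lo hi (Domain S) (Range S)"
proof (rule forestsI)
  show False if "(i, j) \<in> S" "(i', j') \<in> S" "i < i'" "i' < j" "j < j'" for i j i' j'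
    using that assms(2) forestsD(2)[OF T] by blast
  show "i \<in> Domain S \<and> j \<in> Range S \<and> i < j" if "(i, j) \<in> S" for i j
    using that assms(2) forestsD(1)[OF T] by force
qed (use assms(3) in auto)

lemma finite_forest:
  assumes "T \<in> forests lo hi I J" "finite I" "finite J"
  shows "finite T"
  using assms finite_subset[of T "I \<times> J"] by (auto simp: forests_def)

lemma finite_forests:
  assumes "finite I" "finite J"
  shows "finite (forests lo hi I J)"
proof (rule finite_subset)
  show "forests lo hi I J \<subseteq> Pow (I \<times> J)" by (auto simp: forests_def)
qed (use assms in auto)

text \<open>An arc \<open>(i, j)\<close> is \<^emph>\<open>rigid\<close> if \<open>i\<close> is the least neighbour of \<open>j\<close> and \<open>j\<close> the greatest
  neighbour of \<open>i\<close>. An arc with neither property would make two other arcs cross, so counting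
  arcs by these two properties gives \<open>card T = card I + card J\<close> minus the number of rigid arcs.\<close>

definition rigid :: "(nat \<times> nat) set \<Rightarrow> (nat \<times> nat) set" where
  "rigid T = {(i, j) \<in> T. (\<forall>i'. (i', j) \<in> T \<longrightarrow> i \<le> i') \<and> (\<forall>j'. (i, j') \<in> T \<longrightarrow> j' \<le> j)}"

lemma card_forest:
  assumes T: "T \<in> forests lo hi I J" and fin: "finite I" "finite J"
  shows "card T + card (rigid T) = card I + card J"
proof -
  note TD = forestsD[OF T]
  have finT: "finite T" using finite_forest[OF T fin] .
  define A where "A = {(i, j) \<in> T. \<forall>i'. (i', j) \<in> T \<longrightarrow> i \<le> i'}"
  define B where "B = {(i, j) \<in> T. \<forall>j'. (i, j') \<in> T \<longrightarrow> j' \<le> j}"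
  have finAB: "finite A" "finite B"
    using finT by (auto simp: A_def B_def intro: finite_subset[of _ T])
  have "T = A \<union> B"
  proof
    show "T \<subseteq> A \<union> B"
    proof (rule subrelI)
      fix i j assume ij: "(i, j) \<in> T"
      show "(i, j) \<in> A \<union> B"
      proof (rule ccontr)
        assume "(i, j) \<notin> A \<union> B"
        \<comment> \<open>The arcs \<open>(i', j)\<close> and \<open>(i, j')\<close> cross, since
          \<open>i' < i < j < j'\<close>.\<close>
        then obtain i' j' where "(i', j) \<in> T" "i' < i" "(i, j') \<in> T" "j < j'"
          using ij by (force simp: A_def B_def not_le)
        then show False using TD(2)[of i' j i j'] TD(1)[OF ij] by auto
      qed
    qed
  qed (auto simp: A_def B_def)
  moreover have "rigid T = A \<inter> B" by (auto simp: rigid_def A_def B_def)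
  moreover have "card A = card J"
  proof -
    \<comment> \<open>\<open>A\<close> contains for each \<open>j\<close> exactly the arc to its
      least neighbour, so right ends match \<open>A\<close> with \<open>J\<close>. Dually, left ends
      match \<open>B\<close> with \<open>I\<close>.\<close>
    have "inj_on snd A" by (clarsimp simp: inj_on_def A_def) (metis order_antisym)
    moreover have "snd ` A = J"
    proof
      show "J \<subseteq> snd ` A"
      proof
        fix j assume "j \<in> J"
        then have ex: "\<exists>i. (i, j) \<in> T" using TD(5) by blast
        then have "(LEAST i. (i, j) \<in> T, j) \<in> A"
          by (auto simp: A_def intro: LeastI Least_le)
        then show "j \<in> snd ` A" by force
      qed
    qed (use TD(1) in \<open>auto simp: A_def\<close>)
    ultimately show ?thesis using card_image by fastforce
  qed
  moreover have "card B = card I"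
  proof -
    have "inj_on fst B" by (clarsimp simp: inj_on_def B_def) (metis order_antisym)
    moreover have "fst ` B = I"
    proof
      show "I \<subseteq> fst ` B"
      proof
        fix i assume "i \<in> I"
        then obtain j where "(i, j) \<in> T" using TD(4) by blast
        moreover have "finite {j. (i, j) \<in> T}"
          by (rule finite_subset[of _ J]) (use TD(1) fin in auto)
        ultimately have "Max {j. (i, j) \<in> T} \<in> {j. (i, j) \<in> T}"
            "\<forall>j. (i, j) \<in> T \<longrightarrow> j \<le> Max {j. (i, j) \<in> T}"
          using Max_in[of "{j. (i, j) \<in> T}"] by auto
        then have "(i, Max {j. (i, j) \<in> T}) \<in> B" by (auto simp: B_def)
        then show "i \<in> fst ` B" by force
      qed
    qed (use TD(1) in \<open>auto simp: B_def\<close>)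
    ultimately show ?thesis using card_image by fastforce
  qed
  ultimately show ?thesis using card_Un_Int[OF finAB] by simp
qed

section \<open>Forests between two extreme nodes: maximal size, extension, deletion of nodes\<close>

locale node_sets =
  fixes lo hi :: nat and I J :: "nat set"
  assumes fin: "finite I" "finite J"
    and lo_le: "\<And>i. i \<in> I \<Longrightarrow> lo \<le> i"
    and le_hi: "\<And>j. j \<in> J \<Longrightarrow> j \<le> hi"
begin

lemma lo_hi_rigid:
  assumes "T \<in> forests lo hi I J"
  shows "(lo, hi) \<in> rigid T"
  using forestsD[OF assms] lo_le le_hi by (auto simp: rigid_def)

text \<open>The arc \<open>(lo, hi)\<close> is always rigid, so \<open>card_forest\<close> leaves
  room for at most \<open>card I + card J - 1\<close> arcs.\<close>

lemma card_forest_le: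
  assumes T: "T \<in> forests lo hi I J"
  shows "card T + 1 \<le> card I + card J"
proof -
  have "finite (rigid T)"
    using finite_forest[OF T fin] by (auto simp: rigid_def intro: finite_subset[of _ T])
  then have "card (rigid T) > 0" using lo_hi_rigid[OF T] card_gt_0_iff by blast
  then show ?thesis using card_forest[OF T fin] by simp
qed

text \<open>A rigid arc \<open>(i, j)\<close> other than \<open>(lo, hi)\<close> allows a new arc at \<open>j\<close>, to the greatest node
  whose arcs pass over \<open>(i, j)\<close>.\<close>

lemma forest_extend:
  assumes T: "T \<in> forests lo hi I J" and less: "card T + 1 < card I + card J"
  obtains T' where "T' \<in> forests lo hi I J" "T \<subset> T'" "card T' = card T + 1"
proof -
  note TD = forestsD[OF T]
  \<comment> \<open>If \<open>(lo, hi)\<close> were the only rigid arc, \<open>card_forest\<close>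
    would turn the assumed strict inequality into an equality.\<close>
  have "rigid T \<noteq> {(lo, hi)}" using card_forest[OF T fin] less by auto
  then obtain i j where ij: "(i, j) \<in> rigid T" "(i, j) \<noteq> (lo, hi)"
    using lo_hi_rigid[OF T] by auto
  have ijT: "(i, j) \<in> T" and least: "\<And>i'. (i', j) \<in> T \<Longrightarrow> i \<le> i'"
    and greatest: "\<And>j'. (i, j') \<in> T \<Longrightarrow> j' \<le> j"
    using ij(1) by (auto simp: rigid_def)
  \<comment> \<open>For \<open>i = lo\<close> the arc \<open>(lo, hi)\<close> forces the greatest
    neighbour \<open>j\<close> of \<open>i\<close> to be \<open>hi\<close>; the case
    \<open>j = hi\<close> is dual.\<close>
  have "i \<noteq> lo" using ij(2) greatest TD(3) TD(1)[OF ijT] le_hi by (metis order_antisym)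
  moreover have "j \<noteq> hi" using ij(2) least TD(3) TD(1)[OF ijT] lo_le by (metis order_antisym)
  ultimately have lt: "lo < i" "j < hi"
    using lo_le le_hi TD(1)[OF ijT] by (auto simp: order.strict_iff_order)
  \<comment> \<open>The left ends of arcs passing over \<open>(i, j)\<close>. The greatest of them
    is the innermost choice for the new arc to \<open>j\<close>.\<close>
  define P where "P = {p. p < i \<and> (\<exists>q > j. (p, q) \<in> T)}"
  have finP: "finite P" by (rule finite_subset[of _ "{..<i}"]) (auto simp: P_def)
  have "lo \<in> P" using lt TD(3) by (auto simp: P_def)
  define m where "m = Max P"
  have "m \<in> P" using finP \<open>lo \<in> P\<close> Max_in m_def by blast
  then obtain q where q: "m < i" "q > j" "(m, q) \<in> T" by (auto simp: P_def)
  have max: "p \<le> m" if "p < i" "(p, q') \<in> T" "q' > j" for p q'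
    unfolding m_def by (rule Max_ge[OF finP]) (use that in \<open>auto simp: P_def\<close>)
  have new: "(m, j) \<notin> T" using least q by fastforce
  \<comment> \<open>An arc crossing \<open>(m, j)\<close> from the right starts left of
    \<open>i\<close>, against the maximality of \<open>m\<close>, or at \<open>i\<close>, against
    rigidity, or right of \<open>i\<close>, and then it crosses \<open>(i, j)\<close>.\<close>
  have no1: False if "(p, r) \<in> T" "m < p" "p < j" "j < r" for p r
    using that max[of p r] greatest[of r] TD(2)[OF ijT that(1)]
    by (cases p i rule: linorder_cases) auto
  \<comment> \<open>An arc crossing \<open>(m, j)\<close> from the left would already cross
    \<open>(m, q)\<close>, because \<open>j < q\<close>.\<close>
  have no2: False if "(p, r) \<in> T" "p < m" "m < r" "r < j" for p r
    using TD(2)[OF that(1) q(3)] that q by auto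
  have "insert (m, j) T \<in> forests lo hi I J"
  proof (rule forestsI)
    fix u v u' v'
    assume "(u, v) \<in> insert (m, j) T" "(u', v') \<in> insert (m, j) T" "u < u'" "u' < v" "v < v'"
    then show False using no1 no2 TD(2) by auto
  next
    fix u v assume "(u, v) \<in> insert (m, j) T"
    then show "u \<in> I \<and> v \<in> J \<and> u < v" using TD(1) ijT q by fastforce
  qed (use TD(3-5) in blast)+
  moreover have "card (insert (m, j) T) = card T + 1"
    using new finite_forest[OF T fin] by simp
  ultimately show ?thesis using that[of "insert (m, j) T"] new by auto
qed

text \<open>Adjacent nodes \<open>i < j\<close> are always joined, and since \<open>i\<close> and \<open>j\<close> cannot both have a further
  neighbour, at least one of them is a leaf.\<close>

lemma forests_adjacent:
  assumes i: "i \<in> I" "i \<noteq> lo" and j: "j \<in> J" "j \<noteq> hi" and "i < j"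
    and adj: "\<forall>k \<in> I \<union> J. \<not> (i < k \<and> k < j)" and disj: "I \<inter> J = {}"
  shows "forests lo hi I J =
    insert (i, j) ` forests lo hi I (J - {j}) \<union> insert (i, j) ` forests lo hi (I - {i}) J
      \<union> insert (i, j) ` forests lo hi (I - {i}) (J - {j})" (is "_ = ?R")
proof
  show "forests lo hi I J \<subseteq> ?R"
  proof
    fix T assume T: "T \<in> forests lo hi I J"
    note TD = forestsD[OF T]
    obtain j' where j': "(i, j') \<in> T" using TD(4) i by blast
    obtain i' where i': "(i', j) \<in> T" using TD(5) j by blast
    have j'_ge: "j \<le> r" if "(i, r) \<in> T" for r
      using TD(1)[OF that] bspec[OF adj, of r] by fastforce
    have i'_le: "p \<le> i" if "(p, j) \<in> T" for p
      using TD(1)[OF that] bspec[OF adj, of p] by fastforce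
    \<comment> \<open>Otherwise \<open>p < i < j < r\<close>, and the arcs \<open>(p, j)\<close> and
      \<open>(i, r)\<close> cross. Applied to arbitrary arcs at \<open>i\<close> and
      \<open>j\<close>, this also yields the arc \<open>(i, j)\<close> itself.\<close>
    have no: "p = i \<or> r = j" if "(i, r) \<in> T" "(p, j) \<in> T" for p r
      using TD(2)[OF that(2) that(1)] j'_ge[OF that(1)] i'_le[OF that(2)] \<open>i < j\<close> by fastforce
    have ijT: "(i, j) \<in> T" using no[OF j' i'] i' j' by auto
    let ?S = "T - {(i, j)}"
    have T_eq: "T = insert (i, j) ?S" using ijT by auto
    have sub: "Domain ?S \<subseteq> I" "Range ?S \<subseteq> J" using TD(1) by auto
    have covI: "p \<in> Domain ?S" if "p \<in> I" "p \<noteq> i" for p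
    proof -
      obtain q where "(p, q) \<in> ?S" using TD(4) \<open>p \<in> I\<close> \<open>p \<noteq> i\<close> by blast
      then show ?thesis by blast
    qed
    have covJ: "q \<in> Range ?S" if "q \<in> J" "q \<noteq> j" for q
    proof -
      obtain p where "(p, q) \<in> ?S" using TD(5) \<open>q \<in> J\<close> \<open>q \<noteq> j\<close> by blast
      then show ?thesis by blast
    qed
    \<comment> \<open>Removing \<open>(i, j)\<close> can uncover only \<open>i\<close> and
      \<open>j\<close>, so each node set of \<open>?S\<close> is either the old one or the old one
      without that node.\<close>
    have if_eq: "A = (if x \<in> A then X else X - {x})"
      if "A \<subseteq> X" "\<And>p. p \<in> X \<Longrightarrow> p \<noteq> x \<Longrightarrow> p \<in> A" for A X :: "nat set" and x
      using that by auto
    have "Domain ?S = (if i \<in> Domain ?S then I else I - {i})"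
      by (rule if_eq) (fact sub(1), fact covI)
    moreover have "Range ?S = (if j \<in> Range ?S then J else J - {j})"
      by (rule if_eq) (fact sub(2), fact covJ)
    moreover have "?S \<in> forests lo hi (Domain ?S) (Range ?S)"
      by (rule forests_subset[OF T]) (use TD(3) i in auto)
    moreover have "\<not> (i \<in> Domain ?S \<and> j \<in> Range ?S)"
    proof
      assume "i \<in> Domain ?S \<and> j \<in> Range ?S"
      then obtain r p where "(i, r) \<in> ?S" "(p, j) \<in> ?S"
        by blast
      then show False using no by blast
    qed
    ultimately have "?S \<in> forests lo hi I (J - {j}) \<union> forests lo hi (I - {i}) J
        \<union> forests lo hi (I - {i}) (J - {j})"
      by (metis UnCI)
    then show "T \<in> ?R" using T_eq by blast
  qed
next
  \<comment> \<open>Conversely, a crossing with \<open>(i, j)\<close> would need a node strictly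
    between \<open>i\<close> and \<open>j\<close>, so the arc can be restored in all three
    cases.\<close>
  have "insert (i, j) S \<in> forests lo hi I J"
    if S: "S \<in> forests lo hi I' J'"
      and sub: "I' \<subseteq> I" "J' \<subseteq> J" "I \<subseteq> insert i I'" "J \<subseteq> insert j J'" for S I' J'
  proof (rule forestsI)
    fix a b a' b'
    assume A: "(a, b) \<in> insert (i, j) S" "(a', b') \<in> insert (i, j) S" "a < a'" "a' < b" "b < b'"
    have "a \<in> I" "a' \<in> I" "b \<in> J" "b' \<in> J"
      using A(1,2) forestsD(1)[OF S] sub i j by auto
    then show False
      using A bspec[OF adj, of a'] bspec[OF adj, of b] forestsD(2)[OF S, of a b a' b'] by auto
  next
    show "(lo, hi) \<in> insert (i, j) S" using forestsD(3)[OF S] by simp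
  next
    show "\<exists>q. (p, q) \<in> insert (i, j) S" if "p \<in> I" for p
      using that sub forestsD(4)[OF S] by blast
  next
    show "\<exists>p. (p, q) \<in> insert (i, j) S" if "q \<in> J" for q
      using that sub forestsD(5)[OF S] by blast
  qed (use forestsD(1)[OF S] sub i j \<open>i < j\<close> in blast)
  then show "?R \<subseteq> forests lo hi I J" by blast
qed

text \<open>No node of \<open>I\<close> separates \<open>lo\<close> from \<open>j\<close>, so
  \<open>j\<close> is a leaf attached to \<open>lo\<close>; after its removal \<open>lo\<close> is
  still covered by \<open>(lo, hi)\<close>.\<close>

lemma forests_first_J:
  assumes lo: "lo \<in> I" and j: "j \<in> J" "j \<noteq> hi" and "lo < j"
    and adj: "\<forall>k \<in> I \<union> J. \<not> (lo < k \<and> k < j)"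
  shows "forests lo hi I J = insert (lo, j) ` forests lo hi I (J - {j})"
proof
  show "forests lo hi I J \<subseteq> insert (lo, j) ` forests lo hi I (J - {j})"
  proof
    fix T assume T: "T \<in> forests lo hi I J"
    note TD = forestsD[OF T]
    have only: "p = lo" if "(p, j) \<in> T" for p
      using TD(1)[OF that] bspec[OF adj, of p] lo_le[of p] by fastforce
    then have "(lo, j) \<in> T" using TD(5)[OF j(1)] by blast
    moreover have "T - {(lo, j)} \<in> forests lo hi (Domain (T - {(lo, j)})) (Range (T - {(lo, j)}))"
      by (rule forests_subset[OF T]) (use TD(3) j in auto)
    moreover have "Domain (T - {(lo, j)}) = I"
    proof
      show "I \<subseteq> Domain (T - {(lo, j)})"
      proof
        fix p assume "p \<in> I"
        then obtain q where "(p, q) \<in> T" "p \<noteq> lo \<or> q = hi" using TD(3,4) by blast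
        then show "p \<in> Domain (T - {(lo, j)})" using j by force
      qed
    qed (use TD(1) in auto)
    moreover have "Range (T - {(lo, j)}) = J - {j}"
    proof
      show "J - {j} \<subseteq> Range (T - {(lo, j)})" using TD(5) by force
    qed (use TD(1) only in auto)
    moreover have "T = insert (lo, j) (T - {(lo, j)})" using calculation(1) by auto
    ultimately show "T \<in> insert (lo, j) ` forests lo hi I (J - {j})" by (metis imageI)
  qed
next
  have "insert (lo, j) S \<in> forests lo hi I J" if S: "S \<in> forests lo hi I (J - {j})" for S
  proof (rule forestsI)
    fix a b a' b'
    assume A: "(a, b) \<in> insert (lo, j) S" "(a', b') \<in> insert (lo, j) S" "a < a'" "a' < b" "b < b'"
    have "a \<in> I" "a' \<in> I" using A(1,2) forestsD(1)[OF S] lo by auto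
    then show False
      using A bspec[OF adj, of a'] lo_le[of a] forestsD(2)[OF S, of a b a' b'] by auto
  next
    show "(lo, hi) \<in> insert (lo, j) S" using forestsD(3)[OF S] by simp
  next
    show "\<exists>q. (p, q) \<in> insert (lo, j) S" if "p \<in> I" for p
      using that forestsD(4)[OF S] by blast
  next
    show "\<exists>p. (p, q) \<in> insert (lo, j) S" if "q \<in> J" for q
      using that forestsD(5)[OF S] by blast
  qed (use forestsD(1)[OF S] lo j \<open>lo < j\<close> in blast)
  then show "insert (lo, j) ` forests lo hi I (J - {j}) \<subseteq> forests lo hi I J" by blast
qed

end

section \<open>Counting forests by their number of arcs\<close>

lemma card_Collect_Un3:
  assumes "finite X" "finite Y" "finite Z" "X \<inter> Y = {}" "X \<inter> Z = {}" "Y \<inter> Z = {}"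
  shows "card {x \<in> X \<union> Y \<union> Z. P x} = card {x \<in> X. P x} + card {x \<in> Y. P x} + card {x \<in> Z. P x}"
proof -
  have "{x \<in> X \<union> Y \<union> Z. P x} = {x \<in> X. P x} \<union> {x \<in> Y. P x} \<union> {x \<in> Z. P x}" by blast
  also have "card \<dots> = card ({x \<in> X. P x} \<union> {x \<in> Y. P x}) + card {x \<in> Z. P x}"
    by (rule card_Un_disjoint) (use assms in auto)
  also have "card ({x \<in> X. P x} \<union> {x \<in> Y. P x}) = card {x \<in> X. P x} + card {x \<in> Y. P x}"
    by (rule card_Un_disjoint) (use assms in auto)
  finally show ?thesis .
qed

lemma card_insert_image:
  assumes "\<And>T. T \<in> A \<Longrightarrow> finite T \<and> x \<notin> T"
  shows "card {T \<in> insert x ` A. card T = Suc k} = card {T \<in> A. card T = k}"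
proof -
  have "{T \<in> insert x ` A. card T = Suc k} = insert x ` {T \<in> A. card T = k}"
    using assms by auto
  moreover have "inj_on (insert x) {T \<in> A. card T = k}"
    using assms by (auto simp: inj_on_def insert_ident)
  ultimately show ?thesis by (simp add: card_image)
qed

text \<open>The three families of \<open>forests_adjacent\<close> are told apart by which of
  \<open>i\<close> and \<open>j\<close> is still covered once the arc \<open>(i, j)\<close> is
  removed, so their sizes add up.\<close>

lemma (in node_sets) card_forests_adjacent:
  assumes i: "i \<in> I" "i \<noteq> lo" and j: "j \<in> J" "j \<noteq> hi" and "i < j"
    and adj: "\<forall>k \<in> I \<union> J. \<not> (i < k \<and> k < j)" and disj: "I \<inter> J = {}"
  shows "card {T \<in> forests lo hi I J. card T = Suc k} =
    card {T \<in> forests lo hi I (J - {j}). card T = k} +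
    card {T \<in> forests lo hi (I - {i}) J. card T = k} +
    card {T \<in> forests lo hi (I - {i}) (J - {j}). card T = k}"
proof -
  let ?A = "forests lo hi I (J - {j})" and ?B = "forests lo hi (I - {i}) J"
    and ?C = "forests lo hi (I - {i}) (J - {j})"
  have A: "finite T \<and> (i, j) \<notin> T \<and> i \<in> Domain T \<and> j \<notin> Range T" if "T \<in> ?A" for T
    using that fin i finite_forest[OF that] by (auto simp: forests_def)
  have B: "finite T \<and> (i, j) \<notin> T \<and> i \<notin> Domain T \<and> j \<in> Range T" if "T \<in> ?B" for T
    using that fin j finite_forest[OF that] by (auto simp: forests_def)
  have C: "finite T \<and> (i, j) \<notin> T \<and> i \<notin> Domain T \<and> j \<notin> Range T" if "T \<in> ?C" for T
    using that fin finite_forest[OF that] by (auto simp: forests_def)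
  \<comment> \<open>Inserting \<open>(i, j)\<close> is injective on arc sets that lack it, hence
    preserves disjointness.\<close>
  have ne: "insert (i, j) ` X \<inter> insert (i, j) ` Y = {}"
    if "\<And>T. T \<in> X \<Longrightarrow> (i, j) \<notin> T" "\<And>T. T \<in> Y \<Longrightarrow> (i, j) \<notin> T" "X \<inter> Y = {}" for X Y
    using that by (auto simp: insert_ident)
  have disjoint: "?A \<inter> ?B = {}" "?A \<inter> ?C = {}" "?B \<inter> ?C = {}"
    using A B C by (metis disjoint_iff)+
  have d1: "insert (i, j) ` ?A \<inter> insert (i, j) ` ?B = {}"
    by (rule ne) (simp_all add: A B disjoint)
  have d2: "insert (i, j) ` ?A \<inter> insert (i, j) ` ?C = {}"
    by (rule ne) (simp_all add: A C disjoint)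
  have d3: "insert (i, j) ` ?B \<inter> insert (i, j) ` ?C = {}"
    by (rule ne) (simp_all add: B C disjoint)
  have "card {T \<in> forests lo hi I J. card T = Suc k} =
     card {T \<in> insert (i, j) ` ?A. card T = Suc k} +
     card {T \<in> insert (i, j) ` ?B. card T = Suc k} +
     card {T \<in> insert (i, j) ` ?C. card T = Suc k}"
    unfolding forests_adjacent[OF assms]
    by (rule card_Collect_Un3) (use d1 d2 d3 in \<open>simp_all add: finite_forests fin\<close>)
  also have "card {T \<in> insert (i, j) ` ?A. card T = Suc k} = card {T \<in> ?A. card T = k}"
    by (rule card_insert_image) (simp add: A)
  also have "card {T \<in> insert (i, j) ` ?B. card T = Suc k} = card {T \<in> ?B. card T = k}"
    by (rule card_insert_image) (simp add: B)
  also have "card {T \<in> insert (i, j) ` ?C. card T = Suc k} = card {T \<in> ?C. card T = k}"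
    by (rule card_insert_image) (simp add: C)
  finally show ?thesis .
qed

lemma (in node_sets) card_forests_first_J:
  assumes lo: "lo \<in> I" and j: "j \<in> J" "j \<noteq> hi" and "lo < j"
    and adj: "\<forall>k \<in> I \<union> J. \<not> (lo < k \<and> k < j)"
  shows "card {T \<in> forests lo hi I J. card T = Suc k} =
    card {T \<in> forests lo hi I (J - {j}). card T = k}"
proof -
  have "finite T \<and> (lo, j) \<notin> T" if "T \<in> forests lo hi I (J - {j})" for T
    using that fin finite_forest[OF that] by (auto simp: forests_def)
  then show ?thesis
    by (subst forests_first_J[OF assms]) (simp_all add: card_insert_image)
qed

text \<open>Every node of \<open>I\<close> has \<open>hi\<close> as its only possible partner. This
  is the base case, where no north step is left.\<close>

lemma forests_single_J:
  assumes "lo \<in> I" "\<And>i. i \<in> I \<Longrightarrow> i < hi"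
  shows "forests lo hi I {hi} = {I \<times> {hi}}"
proof -
  have "T = I \<times> {hi}" if "T \<in> forests lo hi I {hi}" for T
  proof
    show "I \<times> {hi} \<subseteq> T" using forestsD(1,4)[OF that] by fastforce
  qed (use forestsD(1)[OF that] in auto)
  moreover have "I \<times> {hi} \<in> forests lo hi I {hi}"
    by (rule forestsI) (use assms in auto)
  ultimately show ?thesis by blast
qed

section \<open>Schroeder paths as words\<close>

text \<open>The words of the Schroeder paths above \<open>replicate e East @ w\<close>: \<open>e\<close> is the
  horizontal distance from the current point to the part of \<open>\<nu>\<close> that is still to be read.\<close>

fun schroeder_words :: "nat \<Rightarrow> step list \<Rightarrow> step list set" where
  "schroeder_words e [] = {replicate e East}"
| "schroeder_words e (East # w) = schroeder_words (Suc e) w"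
| "schroeder_words 0 (North # w) = (#) North ` schroeder_words 0 w"
| "schroeder_words (Suc e) (North # w) =
     (#) North ` schroeder_words (Suc e) w \<union> (#) East ` schroeder_words e (North # w)
       \<union> (#) Diag ` schroeder_words e w"
| "schroeder_words e (Diag # w) = {}"

lemma finite_schroeder_words: "finite (schroeder_words e w)"
  by (induction e w rule: schroeder_words.induct) auto

lemma card_Cons_image: "card {\<pi> \<in> (#) s ` A. length \<pi> = Suc k} = card {\<pi> \<in> A. length \<pi> = k}"
proof -
  have "{\<pi> \<in> (#) s ` A. length \<pi> = Suc k} = (#) s ` {\<pi> \<in> A. length \<pi> = k}" by auto
  then show ?thesis by (simp add: card_image)
qed

lemma card_schroeder_words:
  "card {\<pi> \<in> schroeder_words (Suc e) (North # w). length \<pi> = Suc k} =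
     card {\<pi> \<in> schroeder_words (Suc e) w. length \<pi> = k} +
     card {\<pi> \<in> schroeder_words e (North # w). length \<pi> = k} +
     card {\<pi> \<in> schroeder_words e w. length \<pi> = k}"
  unfolding schroeder_words.simps
  by (subst card_Collect_Un3)
    (simp_all only: card_Cons_image finite_schroeder_words finite_imageI, auto)

text \<open>The list \<open>us\<close> holds the east nodes already read and not deleted,
  \<open>ws\<close> the unread nodes with their steps. Only the order of the node numbers matters,
  so the induction can follow \<open>schroeder_words\<close> while nodes disappear.\<close>

lemma card_forests_eq_card_words:
  fixes us :: "nat list" and ws :: "(nat \<times> step) list"
  assumes "sorted_wrt (<) (lo # us @ map fst ws @ [hi])"
    and "snd ` set ws \<subseteq> {North, East}"
  shows "card {T \<in> forests lo hi (insert lo (set us \<union> {x. (x, East) \<in> set ws}))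
                 (insert hi {x. (x, North) \<in> set ws}). card T = Suc k} =
    card {\<pi> \<in> schroeder_words (length us) (map snd ws). length \<pi> = k}"
  using assms
proof (induction "length us" "map snd ws" arbitrary: us ws k rule: schroeder_words.induct)
  case (1 us ws)
  then have [simp]: "ws = []" and srt: "sorted_wrt (<) (lo # us @ [hi])" by auto
  have dist: "distinct (lo # us)" and lt: "\<And>i. i \<in> insert lo (set us) \<Longrightarrow> i < hi"
    using srt by (auto simp: sorted_wrt_append strict_sorted_iff)
  have F: "forests lo hi (insert lo (set us)) {hi} = {insert lo (set us) \<times> {hi}}"
    by (rule forests_single_J) (use lt in auto)
  \<comment> \<open>The star at \<open>hi\<close> has an arc for \<open>lo\<close> and one for each
    element of \<open>us\<close>: one more than the word of east steps has letters.\<close>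
  have "card (insert lo (set us) \<times> {hi}) = Suc (length us)"
    using dist distinct_card[of us] by (simp add: card_cartesian_product)
  then have "{T \<in> {insert lo (set us) \<times> {hi}}. card T = Suc k} =
      (if k = length us then {insert lo (set us) \<times> {hi}} else {})"
    by auto
  moreover have "{\<pi> \<in> schroeder_words (length us) (map snd ws). length \<pi> = k} =
      (if k = length us then {replicate (length us) East} else {})"
    by auto
  moreover have "set us \<union> {x. (x, East) \<in> set ws} = set us" "{x. (x, North) \<in> set ws} = {}"
    by auto
  ultimately show ?case by (simp only: F split: if_split) simp
next
  case (2 w us ws)
  then obtain i ws' where ws: "ws = (i, East) # ws'" by (cases ws) auto
  \<comment> \<open>Reading an east step moves its node from \<open>ws\<close> to \<open>us\<close>
    and changes neither the forests nor the words.\<close>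
  have "card {T \<in> forests lo hi (insert lo (set (us @ [i]) \<union> {x. (x, East) \<in> set ws'}))
                 (insert hi {x. (x, North) \<in> set ws'}). card T = Suc k} =
    card {\<pi> \<in> schroeder_words (length (us @ [i])) (map snd ws'). length \<pi> = k}"
    by (rule 2) (use 2 ws in auto)
  moreover have "set us \<union> {x. (x, East) \<in> set ws} = set (us @ [i]) \<union> {x. (x, East) \<in> set ws'}"
    "{x. (x, North) \<in> set ws} = {x. (x, North) \<in> set ws'}"
    using ws by auto
  ultimately show ?case using ws by simp
next
  case (3 w us ws)
  then obtain j ws' where ws: "ws = (j, North) # ws'" and w: "w = map snd ws'" by (cases ws) auto
  \<comment> \<open>No east node is pending, so \<open>j\<close> follows \<open>lo\<close> directly
    and is a leaf; correspondingly the word must begin with a north step.\<close>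
  have us: "us = []" using 3 by simp
  define E where "E = {x. (x, East) \<in> set ws'}"
  define N where "N = {x. (x, North) \<in> set ws'}"
  have EN_sub: "E \<subseteq> fst ` set ws'" "N \<subseteq> fst ` set ws'" by (force simp: E_def N_def)+
  then have fin: "finite E" "finite N" by (auto intro: finite_subset)
  have "\<forall>x \<in> fst ` set ws'. j < x \<and> x < hi" and lt: "lo < j" "j < hi"
    using 3 ws us by (auto simp: sorted_wrt_append)
  then have gt: "\<And>x. x \<in> E \<union> N \<Longrightarrow> j < x \<and> x < hi" using EN_sub by blast
  have nodes: "insert lo (set us \<union> {x. (x, East) \<in> set ws}) = insert lo E"
    "insert hi {x. (x, North) \<in> set ws} = insert hi (insert j N)"
    using us ws by (auto simp: E_def N_def)
  interpret node_sets lo hi "insert lo E" "insert hi (insert j N)"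
    by unfold_locales (use fin gt lt in \<open>auto intro: less_imp_le less_trans\<close>)
  show ?case
  proof (cases k)
    case 0
    \<comment> \<open>The arc \<open>(lo, hi)\<close> and some arc ending at \<open>j\<close>, where
      \<open>j < hi\<close>, are two different arcs.\<close>
    have "card T \<noteq> Suc 0" if T: "T \<in> forests lo hi (insert lo E) (insert hi (insert j N))" for T
    proof
      assume "card T = Suc 0"
      then obtain x where "T = {x}" using card_1_singletonE by (metis One_nat_def)
      then show False using forestsD(3)[OF T] forestsD(5)[OF T, of j] lt by auto
    qed
    then have "{T \<in> forests lo hi (insert lo E) (insert hi (insert j N)). card T = Suc 0} = {}"
      by blast
    moreover have "{\<pi> \<in> schroeder_words (length us) (map snd ws). length \<pi> = 0} = {}"
      using ws us by auto
    ultimately show ?thesis unfolding nodes 0 by (simp only:) simp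
  next
    case (Suc k')
    have J: "insert hi (insert j N) - {j} = insert hi N" using gt lt by blast
    have "card {T \<in> forests lo hi (insert lo E) (insert hi (insert j N)). card T = Suc k} =
       card {T \<in> forests lo hi (insert lo E) (insert hi N). card T = k}"
      by (subst card_forests_first_J[where j = j]) (use lt gt J in \<open>auto dest: less_asym\<close>)
    also have "\<dots> = card {\<pi> \<in> schroeder_words 0 w. length \<pi> = k'}"
      using "3.hyps"(1)[of us ws' k'] 3 ws us w Suc by (auto simp: E_def N_def)
    also have "\<dots> = card {\<pi> \<in> schroeder_words (length us) (map snd ws). length \<pi> = k}"
      unfolding ws us Suc using card_Cons_image[of North "schroeder_words 0 w" k'] by (simp add: w)
    finally show ?thesis unfolding nodes .
  qed
next
  case (4 e w us ws)
  then obtain j ws' where ws: "ws = (j, North) # ws'" and w: "w = map snd ws'" by (cases ws) auto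
  \<comment> \<open>The last pending east node \<open>i\<close> is the node immediately before
    \<open>j\<close>, which makes the adjacency recursion applicable.\<close>
  obtain us' i where us: "us = us' @ [i]" and e: "e = length us'"
    using "4.hyps"(4) by (cases us rule: rev_cases) auto
  define E where "E = {x. (x, East) \<in> set ws'}"
  define N where "N = {x. (x, North) \<in> set ws'}"
  define I where "I = insert lo (set us \<union> E)"
  define J where "J = insert hi (insert j N)"
  have EN_sub: "E \<subseteq> fst ` set ws'" "N \<subseteq> fst ` set ws'" by (force simp: E_def N_def)+
  then have fin: "finite E" "finite N" by (auto intro: finite_subset)
  have srt: "sorted_wrt (<) (lo # us' @ i # j # map fst ws' @ [hi])"
    and steps: "snd ` set ws' \<subseteq> {North, East}"
    using "4.prems" ws us by auto
  have "\<forall>x \<in> fst ` set ws'. j < x \<and> x < hi" "\<forall>x \<in> set us'. lo < x \<and> x < i"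
    and lt: "lo < i" "i < j" "j < hi"
    using srt by (auto simp: sorted_wrt_append)
  then have gt: "\<And>x. x \<in> E \<union> N \<Longrightarrow> j < x \<and> x < hi" and
    us': "\<And>x. x \<in> set us' \<Longrightarrow> lo < x \<and> x < i" using EN_sub by blast+
  have "distinct (map fst ws')"
    using srt by (auto simp: sorted_wrt_append strict_sorted_iff)
  then have "E \<inter> N = {}"
    by (auto simp: E_def N_def dest: eq_key_imp_eq_value)
  then have disj: "I \<inter> J = {}"
    using gt us' lt by (fastforce simp: I_def J_def us)
  have nodes: "insert lo (set us \<union> {x. (x, East) \<in> set ws}) = I"
    "insert hi {x. (x, North) \<in> set ws} = J"
    using ws by (auto simp: E_def N_def I_def J_def)
  interpret node_sets lo hi I J
  proof
    show "finite I" "finite J" using fin by (auto simp: I_def J_def)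
    show "lo \<le> x" if "x \<in> I" for x
      using that gt[of x] us'[of x] lt by (auto simp: I_def us)
    show "x \<le> hi" if "x \<in> J" for x
      using that gt[of x] lt by (auto simp: J_def)
  qed
  show ?case
  proof (cases k)
    case 0
    have "card T \<noteq> Suc 0" if T: "T \<in> forests lo hi I J" for T
    proof
      assume "card T = Suc 0"
      then obtain x where "T = {x}" using card_1_singletonE by (metis One_nat_def)
      then show False
        using forestsD(3)[OF T] forestsD(5)[OF T, of j] lt by (auto simp: J_def)
    qed
    then have "{T \<in> forests lo hi I J. card T = Suc 0} = {}"
      by blast
    moreover have "{\<pi> \<in> schroeder_words (length us) (map snd ws). length \<pi> = 0} = {}"
      using ws us by auto
    ultimately show ?thesis unfolding nodes 0 by (simp only:) simp
  next
    case (Suc k')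
    have J': "J - {j} = insert hi N" using gt lt by (auto simp: J_def)
    have I': "I - {i} = insert lo (set us' \<union> E)" using gt lt us' by (fastforce simp: I_def us)
    have adj: "\<forall>x \<in> I \<union> J. \<not> (i < x \<and> x < j)"
      using gt us' lt by (force simp: I_def J_def us)
    \<comment> \<open>The summands match the three first letters of a word: deleting
      \<open>j\<close> is a north step, deleting \<open>i\<close> an east step, deleting both a
      diagonal step.\<close>
    have "card {T \<in> forests lo hi I J. card T = Suc k} =
       card {T \<in> forests lo hi I (J - {j}). card T = k} +
       card {T \<in> forests lo hi (I - {i}) J. card T = k} +
       card {T \<in> forests lo hi (I - {i}) (J - {j}). card T = k}"
      by (rule card_forests_adjacent) (use lt adj disj in \<open>simp_all add: I_def J_def us\<close>)
    also have "card {T \<in> forests lo hi I (J - {j}). card T = k} =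
        card {\<pi> \<in> schroeder_words (Suc e) w. length \<pi> = k'}"
      using "4.hyps"(1)[of us ws' k'] srt steps us w e
      by (simp add: J' I_def E_def N_def Suc sorted_wrt_append)
    also have "card {T \<in> forests lo hi (I - {i}) J. card T = k} =
        card {\<pi> \<in> schroeder_words e (North # w). length \<pi> = k'}"
    proof -
      have "{x. (x, East) \<in> set ws} = E" by (auto simp: ws E_def)
      moreover have "card {T \<in> forests lo hi (insert lo (set us' \<union> {x. (x, East) \<in> set ws}))
            (insert hi {x. (x, North) \<in> set ws}). card T = Suc k'} =
          card {\<pi> \<in> schroeder_words (length us') (map snd ws). length \<pi> = k'}"
        by (rule "4.hyps"(2)) (use srt steps ws w e in \<open>simp_all add: sorted_wrt_append\<close>)
      ultimately show ?thesis by (simp only: I' nodes(2) Suc e w) (simp add: ws)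
    qed
    also have "card {T \<in> forests lo hi (I - {i}) (J - {j}). card T = k} =
        card {\<pi> \<in> schroeder_words e w. length \<pi> = k'}"
      using "4.hyps"(3)[of us' ws' k'] srt steps w e
      by (simp add: I' J' E_def N_def Suc sorted_wrt_append)
    finally show ?thesis unfolding nodes
      using card_schroeder_words[of e w k'] by (simp add: Suc us ws e w)
  qed
next
  case (5 w us ws)
  then obtain i ws' where ws: "ws = (i, Diag) # ws'" by (cases ws) auto
  with 5 show ?case by simp
qed

section \<open>Geometry of the words\<close>

text \<open>This is \<open>weakly_above\<close> for arbitrary point sets, so that the upper curve
  can be cut into pieces.\<close>

definition dominates :: "(real \<times> real) set \<Rightarrow> (real \<times> real) set \<Rightarrow> bool" where
  "dominates A B \<longleftrightarrow> (\<forall>u v. (u, v) \<in> A \<longrightarrow> (\<exists>v'\<le>v. (u, v') \<in> B))"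

text \<open>The curve from \<open>(x, y)\<close> that makes \<open>e\<close> east steps and then
  follows \<open>w\<close>. The east run is one segment, from which units can be cut off at the
  left.\<close>

definition shifted_trace :: "real \<Rightarrow> real \<Rightarrow> nat \<Rightarrow> step list \<Rightarrow> (real \<times> real) set" where
  "shifted_trace x y e w = {x..x + real e} \<times> {y} \<union> path_trace (x + real e, y) w"

section \<open>End points and traces of paths\<close>

lemma sum_step_vec:
  "sum_list (map step_vec \<pi>) =
     (real (count_list \<pi> East + count_list \<pi> Diag), real (count_list \<pi> North + count_list \<pi> Diag))"
proof (induction \<pi>)
  case (Cons s \<pi>)
  then show ?case by (cases s) auto
qed (simp add: zero_prod_def)

lemma length_eq_step_counts:
  "length \<pi> = count_list \<pi> North + count_list \<pi> East + count_list \<pi> Diag"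
proof (induction \<pi>)
  case (Cons s \<pi>)
  then show ?case by (cases s) auto
qed simp

lemma start_in_path_trace: "p \<in> path_trace p \<pi>"
  by (cases \<pi>) auto

lemma closed_segment_step:
  "closed_segment (x, y) ((x, y) + step_vec North) = {x} \<times> {y..y + 1}"
  "closed_segment (x, y) ((x, y) + step_vec East) = {x..x + 1} \<times> {y}"
  "closed_segment (x, y) ((x, y) + step_vec Diag) = (\<lambda>t. (x + t, y + t)) ` {0..1}"
proof -
  have *: "closed_segment (x, y) ((x, y) + d) = (\<lambda>t. (x + t * fst d, y + t * snd d)) ` {0..1}" for d
    by (cases d) (auto simp: closed_segment_image_interval image_iff algebra_simps)
  show "closed_segment (x, y) ((x, y) + step_vec North) = {x} \<times> {y..y + 1}"
  proof -
    have "(x, v) \<in> (\<lambda>t. (x, y + t)) ` {0..1}" if "y \<le> v" "v \<le> y + 1" for v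
      using that by (intro image_eqI[of _ _ "v - y"]) auto
    then show ?thesis unfolding * by auto
  qed
  show "closed_segment (x, y) ((x, y) + step_vec East) = {x..x + 1} \<times> {y}"
  proof -
    have "(u, y) \<in> (\<lambda>t. (x + t, y)) ` {0..1}" if "x \<le> u" "u \<le> x + 1" for u
      using that by (intro image_eqI[of _ _ "u - x"]) auto
    then show ?thesis unfolding * by auto
  qed
  show "closed_segment (x, y) ((x, y) + step_vec Diag) = (\<lambda>t. (x + t, y + t)) ` {0..1}"
    unfolding * by simp
qed

lemma path_trace_step:
  "path_trace (x, y) (North # \<pi>) = {x} \<times> {y..y + 1} \<union> path_trace (x, y + 1) \<pi>"
  "path_trace (x, y) (East # \<pi>) = {x..x + 1} \<times> {y} \<union> path_trace (x + 1, y) \<pi>"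
  "path_trace (x, y) (Diag # \<pi>) = (\<lambda>t. (x + t, y + t)) ` {0..1} \<union> path_trace (x + 1, y + 1) \<pi>"
  by (simp_all only: path_trace.simps closed_segment_step) simp_all

lemma path_trace_ge:
  assumes "(u, v) \<in> path_trace (x, y) \<pi>"
  shows "x \<le> u \<and> y \<le> v"
  using assms
proof (induction \<pi> arbitrary: x y)
  case (Cons s \<pi>)
  show ?case
  proof (cases s)
    case North
    then show ?thesis using Cons.prems Cons.IH[of x "y + 1"] by (auto simp only: path_trace_step) auto
  next
    case East
    then show ?thesis using Cons.prems Cons.IH[of "x + 1" y] by (auto simp only: path_trace_step) auto
  next
    case Diag
    then show ?thesis using Cons.prems Cons.IH[of "x + 1" "y + 1"] by (auto simp only: path_trace_step) auto
  qed
qed simp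

section \<open>Removing the first step of the upper path\<close>

lemma dominates_Un: "dominates (A \<union> B) C \<longleftrightarrow> dominates A C \<and> dominates B C"
  by (auto simp: dominates_def)

text \<open>Right of \<open>x\<close> the lower curve has height at least \<open>y + 1\<close>,
  while the step is still below that at \<open>x + 1/2\<close>. An interior point is needed, since
  the end of a diagonal step may lie on the lower curve.\<close>

lemma not_dominates_North:
  assumes "s = East \<or> s = Diag"
  shows "\<not> dominates (path_trace (x, y) (s # \<pi>)) (shifted_trace x y 0 (North # w))"
proof
  assume D: "dominates (path_trace (x, y) (s # \<pi>)) (shifted_trace x y 0 (North # w))"
  obtain v where v: "(x + 1/2, v) \<in> path_trace (x, y) (s # \<pi>)" "v < y + 1"
  proof (cases "s = East")
    case True
    then show ?thesis using that[of y] by (simp only: path_trace_step) auto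
  next
    case False
    then have "s = Diag" using assms by simp
    moreover have "(x + 1/2, y + 1/2) \<in> (\<lambda>t. (x + t, y + t)) ` {0..1}" by force
    ultimately show ?thesis using that[of "y + 1/2"] by (simp only: path_trace_step) auto
  qed
  then obtain v' where "v' \<le> v" "(x + 1/2, v') \<in> shifted_trace x y 0 (North # w)"
    using D unfolding dominates_def by blast
  then have "(x + 1/2, v') \<in> path_trace (x, y + 1) w"
    by (simp only: shifted_trace_def path_trace_step) auto
  then show False using path_trace_ge \<open>v' \<le> v\<close> v(2) by fastforce
qed

text \<open>The rest of the upper path has height at least \<open>y + 1\<close>. Hence it makes no
  difference whether the east run lies at height \<open>y\<close> or, with the north step moved in
  front of it, at \<open>y + 1\<close>; beyond the run both lower curves agree.\<close>

lemma dominates_North: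
  "dominates (path_trace (x, y) (North # \<pi>)) (shifted_trace x y e (North # w)) \<longleftrightarrow>
     dominates (path_trace (x, y + 1) \<pi>) (shifted_trace x (y + 1) e w)" (is "?L \<longleftrightarrow> ?R")
proof
  assume L: ?L
  show ?R unfolding dominates_def
  proof (intro allI impI)
    fix u v assume uv: "(u, v) \<in> path_trace (x, y + 1) \<pi>"
    then have ge: "x \<le> u" "y + 1 \<le> v" using path_trace_ge by blast+
    obtain v' where "v' \<le> v" "(u, v') \<in> shifted_trace x y e (North # w)"
      using L uv unfolding dominates_def by (auto simp only: path_trace_step)
    then consider "u \<le> x + real e" | "(u, v') \<in> path_trace (x + real e, y + 1) w"
      by (auto simp only: shifted_trace_def path_trace_step) auto
    then show "\<exists>v'\<le>v. (u, v') \<in> shifted_trace x (y + 1) e w"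
    proof cases
      case 1
      then show ?thesis using ge by (intro exI[of _ "y + 1"]) (simp add: shifted_trace_def)
    next
      case 2
      then show ?thesis using \<open>v' \<le> v\<close> by (auto simp: shifted_trace_def)
    qed
  qed
next
  assume R: ?R
  have "dominates ({x} \<times> {y..y + 1}) (shifted_trace x y e (North # w))"
    unfolding dominates_def shifted_trace_def by auto
  moreover have "dominates (path_trace (x, y + 1) \<pi>) (shifted_trace x y e (North # w))"
    unfolding dominates_def
  proof (intro allI impI)
    fix u v assume uv: "(u, v) \<in> path_trace (x, y + 1) \<pi>"
    then have ge: "x \<le> u" "y + 1 \<le> v" using path_trace_ge by blast+
    obtain v' where v': "v' \<le> v" "(u, v') \<in> shifted_trace x (y + 1) e w"
      using R uv unfolding dominates_def by blast
    then consider "u \<le> x + real e" | "(u, v') \<in> path_trace (x + real e, y + 1) w"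
      by (auto simp: shifted_trace_def)
    then show "\<exists>v'\<le>v. (u, v') \<in> shifted_trace x y e (North # w)"
    proof cases
      case 1
      then show ?thesis using ge by (intro exI[of _ y]) (simp add: shifted_trace_def)
    next
      case 2
      then show ?thesis
        using v'(1) by (intro exI[of _ v']) (simp only: shifted_trace_def path_trace_step, simp)
    qed
  qed
  ultimately show ?L by (simp only: path_trace_step(1)[of x y \<pi>] dominates_Un simp_thms)
qed

text \<open>The step runs along the first unit of the east run, and from abscissa
  \<open>x + 1\<close> on the two lower curves coincide.\<close>

lemma dominates_East:
  "dominates (path_trace (x, y) (East # \<pi>)) (shifted_trace x y (Suc e) w) \<longleftrightarrow>
     dominates (path_trace (x + 1, y) \<pi>) (shifted_trace (x + 1) y e w)" (is "?L \<longleftrightarrow> ?R")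
proof -
  have eq: "(u, v) \<in> shifted_trace x y (Suc e) w \<longleftrightarrow> (u, v) \<in> shifted_trace (x + 1) y e w"
    if "x + 1 \<le> u" for u v
    using that by (auto simp: shifted_trace_def algebra_simps)
  have "dominates ({x..x + 1} \<times> {y}) (shifted_trace x y (Suc e) w)"
    unfolding dominates_def shifted_trace_def by auto
  moreover have "dominates (path_trace (x + 1, y) \<pi>) (shifted_trace x y (Suc e) w) \<longleftrightarrow> ?R"
    unfolding dominates_def using eq path_trace_ge by metis
  ultimately show ?thesis by (simp only: path_trace_step dominates_Un simp_thms)
qed

text \<open>The diagonal lies above the first unit of the east run, so it constrains the rest of the
  path exactly as an east step followed by a north step would.\<close>

lemma dominates_Diag:
  "dominates (path_trace (x, y) (Diag # \<pi>)) (shifted_trace x y (Suc e) (North # w)) \<longleftrightarrow>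
     dominates (path_trace (x + 1, y + 1) \<pi>) (shifted_trace (x + 1) (y + 1) e w)" (is "?L \<longleftrightarrow> ?R")
proof -
  have "dominates ((\<lambda>t. (x + t, y + t)) ` {0..1}) (shifted_trace x y (Suc e) (North # w))"
    unfolding dominates_def
  proof (intro allI impI)
    fix u v assume "(u, v) \<in> (\<lambda>t. (x + t, y + t)) ` {0..1}"
    then show "\<exists>v'\<le>v. (u, v') \<in> shifted_trace x y (Suc e) (North # w)"
      by (intro exI[of _ y]) (auto simp: shifted_trace_def)
  qed
  then have "?L \<longleftrightarrow> dominates (path_trace (x + 1, y + 1) \<pi>) (shifted_trace x y (Suc e) (North # w))"
    by (simp only: path_trace_step(3) dominates_Un simp_thms)
  \<comment> \<open>A vertical unit at \<open>x + 1\<close> is put in front of the rest, so that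
    \<open>dominates_North\<close> becomes applicable.\<close>
  also have "\<dots> \<longleftrightarrow>
      dominates (path_trace (x + 1, y) (North # \<pi>)) (shifted_trace (x + 1) y e (North # w))"
  proof -
    have eq: "(u, v) \<in> shifted_trace x y (Suc e) (North # w) \<longleftrightarrow>
        (u, v) \<in> shifted_trace (x + 1) y e (North # w)" if "x + 1 \<le> u" for u v
      using that by (auto simp: shifted_trace_def algebra_simps)
    have "dominates ({x + 1} \<times> {y..y + 1}) (shifted_trace (x + 1) y e (North # w))"
      unfolding dominates_def shifted_trace_def by auto
    moreover have "dominates (path_trace (x + 1, y + 1) \<pi>) (shifted_trace x y (Suc e) (North # w)) \<longleftrightarrow>
        dominates (path_trace (x + 1, y + 1) \<pi>) (shifted_trace (x + 1) y e (North # w))"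
      unfolding dominates_def using eq path_trace_ge by metis
    ultimately show ?thesis by (simp only: path_trace_step(1)[of _ _ \<pi>] dominates_Un simp_thms)
  qed
  also have "\<dots> \<longleftrightarrow> ?R" by (rule dominates_North)
  finally show ?thesis .
qed

lemma shifted_trace_East: "shifted_trace x y e (East # w) = shifted_trace x y (Suc e) w"
proof -
  have "{x..x + real (Suc e)} \<times> {y} = {x..x + real e} \<times> {y} \<union> {x + real e..x + real e + 1} \<times> {y}"
    by auto
  then show ?thesis unfolding shifted_trace_def path_trace_step
    by (simp add: Un_assoc algebra_simps)
qed

lemma dominates_replicate_East:
  "dominates (path_trace (x, y) (replicate e East)) (shifted_trace x y e w)"
proof (induction e arbitrary: x)
  case 0
  then show ?case by (auto simp: dominates_def shifted_trace_def)
next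
  case (Suc e)
  then show ?case by (simp only: replicate_Suc dominates_East)
qed

lemma count_list_zero_imp_replicate_East:
  assumes "count_list \<pi> North = 0" "count_list \<pi> Diag = 0"
  shows "\<pi> = replicate (count_list \<pi> East) East"
  using assms
proof (induction \<pi>)
  case (Cons s \<pi>)
  then show ?case by (cases s) auto
qed simp

text \<open>Induction along the recursion for words: the first letter of \<open>\<pi>\<close>
  selects the matching lemma on \<open>dominates\<close>. The starting point is arbitrary because
  each letter moves it.\<close>

lemma schroeder_words_iff:
  assumes "set w \<subseteq> {North, East}"
  shows "\<pi> \<in> schroeder_words e w \<longleftrightarrow>
    sum_list (map step_vec \<pi>) = (real (e + count_list w East), real (count_list w North)) \<and>
    dominates (path_trace (x, y) \<pi>) (shifted_trace x y e w)"
  using assms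
proof (induction e w arbitrary: \<pi> x y rule: schroeder_words.induct)
  case (1 e)
  \<comment> \<open>A path ending at height 0 has neither north nor diagonal steps.\<close>
  have "\<pi> = replicate e East \<longleftrightarrow> sum_list (map step_vec \<pi>) = (real e, 0)"
  proof
    assume "sum_list (map step_vec \<pi>) = (real e, 0)"
    then have "count_list \<pi> North = 0" "count_list \<pi> Diag = 0" "count_list \<pi> East = e"
      by (simp_all add: sum_step_vec)
    then show "\<pi> = replicate e East" using count_list_zero_imp_replicate_East by metis
  next
    have "sum_list (replicate e (1, 0)) = (real e, 0::real)"
      by (induction e) (simp_all add: zero_prod_def)
    then show "sum_list (map step_vec \<pi>) = (real e, 0)" if "\<pi> = replicate e East"
      using that by simp
  qed
  then show ?case using dominates_replicate_East[of x y e "[]"] by auto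
next
  case (2 e w)
  then show ?case by (simp add: shifted_trace_East)
next
  case (3 w)
  show ?case
  proof (cases \<pi>)
    case (Cons s \<pi>')
    show ?thesis
    proof (cases "s = North")
      case True
      have "\<pi> \<in> schroeder_words 0 (North # w) \<longleftrightarrow> \<pi>' \<in> schroeder_words 0 w"
        by (auto simp: Cons True)
      moreover have "sum_list (map step_vec \<pi>) = (real (0 + count_list (North # w) East), real (count_list (North # w) North))
        \<longleftrightarrow> sum_list (map step_vec \<pi>') = (real (0 + count_list w East), real (count_list w North))"
        by (auto simp: sum_step_vec Cons True)
      ultimately show ?thesis
        using 3 dominates_North[of x y \<pi>' 0 w] by (simp add: Cons True del: path_trace.simps schroeder_words.simps)
    next
      case False
      then have "s = East \<or> s = Diag" by (cases s) auto
      then show ?thesis using not_dominates_North[of s x y \<pi>' w] False Cons by auto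
    qed
  qed (auto simp: zero_prod_def)
next
  case (4 e w)
  show ?case
  proof (cases \<pi>)
    case (Cons s \<pi>')
    show ?thesis
    proof (cases s)
      case North
      have "\<pi> \<in> schroeder_words (Suc e) (North # w) \<longleftrightarrow> \<pi>' \<in> schroeder_words (Suc e) w"
        by (auto simp: Cons North)
      moreover have "sum_list (map step_vec \<pi>) = (real (Suc e + count_list (North # w) East), real (count_list (North # w) North))
        \<longleftrightarrow> sum_list (map step_vec \<pi>') = (real (Suc e + count_list w East), real (count_list w North))"
        by (auto simp: sum_step_vec Cons North)
      ultimately show ?thesis
        using "4.IH"(1)[of \<pi>' x "y + 1"] "4.prems" dominates_North[of x y \<pi>' "Suc e" w]
        by (simp add: Cons North del: path_trace.simps schroeder_words.simps)
    next
      case East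
      have "\<pi> \<in> schroeder_words (Suc e) (North # w) \<longleftrightarrow> \<pi>' \<in> schroeder_words e (North # w)"
        by (auto simp: Cons East)
      moreover have "sum_list (map step_vec \<pi>) = (real (Suc e + count_list (North # w) East), real (count_list (North # w) North))
        \<longleftrightarrow> sum_list (map step_vec \<pi>') = (real (e + count_list (North # w) East), real (count_list (North # w) North))"
        by (auto simp: sum_step_vec Cons East)
      ultimately show ?thesis
        using "4.IH"(2)[of \<pi>' "x + 1" y] "4.prems" dominates_East[of x y \<pi>' e "North # w"]
        by (simp add: Cons East del: path_trace.simps schroeder_words.simps)
    next
      case Diag
      have "\<pi> \<in> schroeder_words (Suc e) (North # w) \<longleftrightarrow> \<pi>' \<in> schroeder_words e w"
        by (auto simp: Cons Diag)
      moreover have "sum_list (map step_vec \<pi>) = (real (Suc e + count_list (North # w) East), real (count_list (North # w) North))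
        \<longleftrightarrow> sum_list (map step_vec \<pi>') = (real (e + count_list w East), real (count_list w North))"
        by (auto simp: sum_step_vec Cons Diag)
      ultimately show ?thesis
        using "4.IH"(3)[of \<pi>' "x + 1" "y + 1"] "4.prems" dominates_Diag[of x y \<pi>' e w]
        by (simp add: Cons Diag del: path_trace.simps schroeder_words.simps)
    qed
  qed (auto simp: zero_prod_def)
next
  case (5 e w)
  then show ?case by simp
qed

text \<open>With the end point fixed, each diagonal step takes the place of one north and one east
  step, so \<open>i\<close> diagonal steps shorten the word by \<open>i\<close>.\<close>

lemma sch_eq_card_words:
  assumes "lattice_path b a \<nu>"
  shows "sch \<nu> i = card {\<pi> \<in> schroeder_words 0 \<nu>. length \<pi> + i = length \<nu>}"
proof -
  have \<nu>: "set \<nu> \<subseteq> {North, East}" using assms by (simp add: lattice_path_def)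
  \<comment> \<open>For \<open>e = 0\<close> the east run is the single starting point, which
    belongs to the trace anyway.\<close>
  have "shifted_trace 0 0 0 \<nu> = path_trace (0, 0) \<nu>"
    using start_in_path_trace[of "(0, 0)" \<nu>] by (auto simp: shifted_trace_def)
  then have iff: "schroeder_path (count_list \<nu> East) (count_list \<nu> North) \<nu> \<pi> \<longleftrightarrow>
      \<pi> \<in> schroeder_words 0 \<nu>" for \<pi>
    unfolding schroeder_words_iff[OF \<nu>, of \<pi> 0 0 0] schroeder_path_def weakly_above_def dominates_def
    by auto blast
  have "count_list \<nu> Diag = 0" using \<nu> by (auto simp: count_list_0_iff)
  then have "count_list \<pi> Diag = i \<longleftrightarrow> length \<pi> + i = length \<nu>" if "\<pi> \<in> schroeder_words 0 \<nu>" for \<pi>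
    using that unfolding schroeder_words_iff[OF \<nu>, of \<pi> 0 0 0] sum_step_vec
      length_eq_step_counts[of \<pi>] length_eq_step_counts[of \<nu>] by auto
  then show ?thesis unfolding sch_def iff by (metis (no_types, lifting))
qed

section \<open>Dimension of faces\<close>

lemma mem_nodes_iff:
  "k \<in> I_nodes \<nu> \<longleftrightarrow> k = 1 \<or> (2 \<le> k \<and> k \<le> length \<nu> + 1 \<and> \<nu> ! (k - 2) = East)"
  "k \<in> J_nodes \<nu> \<longleftrightarrow> k = length \<nu> + 2 \<or> (2 \<le> k \<and> k \<le> length \<nu> + 1 \<and> \<nu> ! (k - 2) = North)"
  by (auto simp: I_nodes_def J_nodes_def num_nodes_def)

lemma nodes_partition:
  assumes "set \<nu> \<subseteq> {North, East}"
  shows "I_nodes \<nu> \<inter> J_nodes \<nu> = {}" "I_nodes \<nu> \<union> J_nodes \<nu> = {1..num_nodes \<nu>}"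
proof -
  have step: "\<nu> ! (k - 2) = North \<or> \<nu> ! (k - 2) = East" if "2 \<le> k" "k \<le> length \<nu> + 1" for k
  proof -
    have "k - 2 < length \<nu>" using that by simp
    then show ?thesis using assms nth_mem by blast
  qed
  show "I_nodes \<nu> \<union> J_nodes \<nu> = {1..num_nodes \<nu>}"
  proof (rule set_eqI)
    fix k
    consider "k = 0" | "k = 1" | "2 \<le> k" "k \<le> length \<nu> + 1" | "k = length \<nu> + 2" | "length \<nu> + 2 < k"
      by linarith
    then show "k \<in> I_nodes \<nu> \<union> J_nodes \<nu> \<longleftrightarrow> k \<in> {1..num_nodes \<nu>}"
      using step[of k] by cases (auto simp: mem_nodes_iff num_nodes_def)
  qed
  show "I_nodes \<nu> \<inter> J_nodes \<nu> = {}"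
    by (auto simp: mem_nodes_iff)
qed

text \<open>As \<open>I\<close> and \<open>J\<close> are disjoint, a node of \<open>I\<close> can be
  covered only as a left end and a node of \<open>J\<close> only as a right end.\<close>

lemma covering_forest_iff:
  assumes "set \<nu> \<subseteq> {North, East}"
  shows "covering_forest \<nu> T \<longleftrightarrow> T \<in> forests 1 (num_nodes \<nu>) (I_nodes \<nu>) (J_nodes \<nu>)"
proof -
  have "(\<forall>k \<in> {1..num_nodes \<nu>}. \<exists>(i, j) \<in> T. k = i \<or> k = j) \<longleftrightarrow>
      I_nodes \<nu> \<subseteq> Domain T \<and> J_nodes \<nu> \<subseteq> Range T" if T: "T \<subseteq> I_nodes \<nu> \<times> J_nodes \<nu>"
    unfolding nodes_partition(2)[OF assms, symmetric]
  proof
    assume cov: "\<forall>k \<in> I_nodes \<nu> \<union> J_nodes \<nu>. \<exists>(i, j) \<in> T. k = i \<or> k = j"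
    have "k \<in> Domain T" if "k \<in> I_nodes \<nu>" for k
    proof -
      obtain i j where "(i, j) \<in> T" "k = i \<or> k = j" using cov \<open>k \<in> I_nodes \<nu>\<close> by blast
      then show ?thesis using T nodes_partition(1)[OF assms] \<open>k \<in> I_nodes \<nu>\<close> by blast
    qed
    moreover have "k \<in> Range T" if "k \<in> J_nodes \<nu>" for k
    proof -
      obtain i j where "(i, j) \<in> T" "k = i \<or> k = j" using cov \<open>k \<in> J_nodes \<nu>\<close> by blast
      then show ?thesis using T nodes_partition(1)[OF assms] \<open>k \<in> J_nodes \<nu>\<close> by blast
    qed
    ultimately show "I_nodes \<nu> \<subseteq> Domain T \<and> J_nodes \<nu> \<subseteq> Range T" by blast
  next
    assume "I_nodes \<nu> \<subseteq> Domain T \<and> J_nodes \<nu> \<subseteq> Range T"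
    then show "\<forall>k \<in> I_nodes \<nu> \<union> J_nodes \<nu>. \<exists>(i, j) \<in> T. k = i \<or> k = j" by blast
  qed
  moreover have "\<not> (\<exists>i j i' j'. (i, j) \<in> T \<and> (i', j') \<in> T \<and> i < i' \<and> i' < j \<and> j < j') \<longleftrightarrow>
      (\<forall>i j i' j'. (i, j) \<in> T \<longrightarrow> (i', j') \<in> T \<longrightarrow> \<not> (i < i' \<and> i' < j \<and> j < j'))"
    by blast
  ultimately show ?thesis
    unfolding covering_forest_def IJ_forest_def forests_def mem_Collect_eq
    by (cases "T \<subseteq> I_nodes \<nu> \<times> J_nodes \<nu>") (simp_all only: simp_thms conj_ac)
qed

lemma node_sets_nodes: "node_sets 1 (num_nodes \<nu>) (I_nodes \<nu>) (J_nodes \<nu>)"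
proof
  show "finite (I_nodes \<nu>)" "finite (J_nodes \<nu>)"
    by (rule finite_subset[of _ "{..num_nodes \<nu>}"]; auto simp: mem_nodes_iff num_nodes_def)+
qed (auto simp: mem_nodes_iff num_nodes_def)

lemma card_nodes:
  assumes "set \<nu> \<subseteq> {North, East}"
  shows "card (I_nodes \<nu>) + card (J_nodes \<nu>) = length \<nu> + 2"
proof -
  interpret node_sets 1 "num_nodes \<nu>" "I_nodes \<nu>" "J_nodes \<nu>" by (rule node_sets_nodes)
  have "card (I_nodes \<nu>) + card (J_nodes \<nu>) = card (I_nodes \<nu> \<union> J_nodes \<nu>)"
    using card_Un_disjoint[OF fin nodes_partition(1)[OF assms]] by simp
  then show ?thesis by (simp add: nodes_partition(2)[OF assms] num_nodes_def)
qed

lemma card_covering_forests: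
  assumes \<nu>: "set \<nu> \<subseteq> {North, East}"
  shows "card {T. covering_forest \<nu> T \<and> card T = Suc k} =
    card {\<pi> \<in> schroeder_words 0 \<nu>. length \<pi> = k}"
proof -
  \<comment> \<open>Step \<open>n\<close> of \<open>\<nu>\<close>, counted from 0, belongs to node
    \<open>n + 2\<close>; node 1 is \<open>lo\<close> and no east node has been read yet.\<close>
  define ws where "ws = map (\<lambda>n. (n + 2, \<nu> ! n)) [0..<length \<nu>]"
  have fst_ws: "map fst ws = map (\<lambda>n. n + 2) [0..<length \<nu>]" and snd_ws: "map snd ws = \<nu>"
    using map_nth[of \<nu>] by (simp_all add: ws_def comp_def del: map_nth)
  have mem: "(x, s) \<in> set ws \<longleftrightarrow> 2 \<le> x \<and> x \<le> length \<nu> + 1 \<and> \<nu> ! (x - 2) = s" for x s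
  proof -
    have "(x, s) \<in> set ws \<longleftrightarrow> (\<exists>n < length \<nu>. x = n + 2 \<and> s = \<nu> ! n)"
      by (auto simp: ws_def)
    also have "\<dots> \<longleftrightarrow> 2 \<le> x \<and> x \<le> length \<nu> + 1 \<and> \<nu> ! (x - 2) = s"
      by (auto intro!: exI[of _ "x - 2"])
    finally show ?thesis .
  qed
  have I: "insert 1 (set [] \<union> {x. (x, East) \<in> set ws}) = I_nodes \<nu>"
    and J: "insert (num_nodes \<nu>) {x. (x, North) \<in> set ws} = J_nodes \<nu>"
    by (auto simp: mem mem_nodes_iff num_nodes_def)
  have "snd ` set ws \<subseteq> {North, East}" using \<nu> snd_ws by (metis set_map)
  moreover have "sorted_wrt (<) (1 # [] @ map fst ws @ [num_nodes \<nu>])"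
    by (auto simp: fst_ws num_nodes_def sorted_wrt_append sorted_wrt_map)
  ultimately show ?thesis
    using card_forests_eq_card_words[of 1 "[]" ws "num_nodes \<nu>" k]
    unfolding covering_forest_iff[OF \<nu>] I J snd_ws by simp
qed

text \<open>The bijection preserves only the order, so the dimension is recovered from chains:
  adding arcs one at a time bounds it from below, descending through facets bounds it from
  above.\<close>

lemma aff_dim_face:
  fixes K :: "'a::euclidean_space set set"
  assumes \<nu>: "set \<nu> \<subseteq> {North, East}" and K: "polyhedral_complex K"
    and bij: "bij_betw \<phi> (nonempty_faces K) {T. covering_forest \<nu> T}"
    and ord: "\<forall>F \<in> nonempty_faces K. \<forall>G \<in> nonempty_faces K. F \<subseteq> G \<longleftrightarrow> \<phi> G \<subseteq> \<phi> F"
    and F: "F \<in> nonempty_faces K"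
  shows "aff_dim F + int (card (\<phi> F)) = int (length \<nu> + 1)"
proof -
  interpret node_sets 1 "num_nodes \<nu>" "I_nodes \<nu>" "J_nodes \<nu>" by (rule node_sets_nodes)
  have forest: "\<phi> F \<in> forests 1 (num_nodes \<nu>) (I_nodes \<nu>) (J_nodes \<nu>)"
    if "F \<in> nonempty_faces K" for F
    using bij_betwE[OF bij] that covering_forest_iff[OF \<nu>] by blast
  have card_le: "card (\<phi> F) \<le> length \<nu> + 1" if "F \<in> nonempty_faces K" for F
    using card_forest_le[OF forest[OF that]] card_nodes[OF \<nu>] by simp
  have dim_nonneg: "aff_dim F \<ge> 0" if "F \<in> nonempty_faces K" for F
    using that aff_dim_geq[of F] aff_dim_empty[of F] by (auto simp: nonempty_faces_def order.strict_iff_order)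
  have dim_less: "aff_dim G < aff_dim F"
    if "F \<in> nonempty_faces K" "G \<in> nonempty_faces K" "G \<subset> F" for F G
  proof -
    have "F \<in> K" "G \<in> K" using that by (auto simp: nonempty_faces_def)
    then have "(F \<inter> G) face_of F" "convex F"
      using K polytope_imp_convex unfolding polyhedral_complex_def by blast+
    then show ?thesis using that(3) face_of_aff_dim_lt by (metis inf.absorb2 psubset_eq)
  qed
  \<comment> \<open>One further arc gives a strictly smaller face, so the dimension drops by at
    least 1 while the number of arcs grows by exactly 1.\<close>
  have lower: "int (length \<nu> + 1) \<le> aff_dim F + int (card (\<phi> F))" if "F \<in> nonempty_faces K" for F
    using that
  proof (induction "length \<nu> + 1 - card (\<phi> F)" arbitrary: F rule: less_induct)
    case less
    show ?case
    proof (cases "card (\<phi> F) = length \<nu> + 1")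
      case True
      then show ?thesis using dim_nonneg[OF less.prems] by simp
    next
      case False
      then have lt: "card (\<phi> F) < length \<nu> + 1" using card_le[OF less.prems] by simp
      then obtain T where T: "T \<in> forests 1 (num_nodes \<nu>) (I_nodes \<nu>) (J_nodes \<nu>)" "\<phi> F \<subset> T"
        "card T = card (\<phi> F) + 1"
        using forest_extend[OF forest[OF less.prems]] card_nodes[OF \<nu>] by auto
      then obtain G where G: "G \<in> nonempty_faces K" "\<phi> G = T"
        using bij covering_forest_iff[OF \<nu>] unfolding bij_betw_def by (metis imageE mem_Collect_eq)
      have "G \<subset> F" using ord G less.prems T(2) by (metis psubset_eq)
      then have "aff_dim G < aff_dim F" using dim_less less.prems G by blast
      moreover have "int (length \<nu> + 1) \<le> aff_dim G + int (card (\<phi> G))"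
        by (rule less.hyps) (use G T lt in auto)
      ultimately show ?thesis using G T by simp
    qed
  qed
  \<comment> \<open>Passing to a facet lowers the dimension by exactly 1 and adds at least one arc;
    at dimension 0 the bound on the number of arcs finishes the descent.\<close>
  have upper: "aff_dim F + int (card (\<phi> F)) \<le> int (length \<nu> + 1)" if "F \<in> nonempty_faces K" for F
    using that
  proof (induction "nat (aff_dim F)" arbitrary: F rule: less_induct)
    case less
    show ?case
    proof (cases "aff_dim F = 0")
      case True
      then show ?thesis using card_le[OF less.prems] by simp
    next
      case False
      then have pos: "aff_dim F > 0" using dim_nonneg[OF less.prems] by simp
      have FK: "F \<in> K" "polytope F"
        using less.prems K by (auto simp: nonempty_faces_def polyhedral_complex_def)
      then obtain G where G: "G facet_of F" using polytope_facet_exists pos by blast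
      then have "G \<in> K" using FK K unfolding polyhedral_complex_def facet_of_def by blast
      then have GK: "G \<in> nonempty_faces K" using G by (simp add: nonempty_faces_def facet_of_def)
      have dim: "aff_dim G = aff_dim F - 1" using G by (simp add: facet_of_def)
      have "G \<subset> F" using G dim by (auto simp: facet_of_def dest: face_of_imp_subset)
      then have "\<phi> F \<subset> \<phi> G" using ord GK less.prems by (metis psubset_eq subset_antisym)
      then have "card (\<phi> F) < card (\<phi> G)"
        using finite_forest[OF forest[OF GK] fin] psubset_card_mono by blast
      moreover have "aff_dim G + int (card (\<phi> G)) \<le> int (length \<nu> + 1)"
        by (rule less.hyps) (use GK dim pos in auto)
      ultimately show ?thesis using dim by linarith
    qed
  qed
  show ?thesis using lower[OF F] upper[OF F] by simp
qed

section \<open>Face numbers as Schroeder numbers\<close>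

theorem corollary4p8:
  fixes a b :: nat and \<nu> :: "step list" and K :: "'a::euclidean_space set set"
  assumes "lattice_path b a \<nu>"
    and "nu_associahedron \<nu> K"
  shows "\<forall>i::nat. card {F \<in> nonempty_faces K. aff_dim F = int i} = sch \<nu> i"
proof
  fix i :: nat
  have \<nu>: "set \<nu> \<subseteq> {North, East}" using assms(1) by (simp add: lattice_path_def)
  obtain \<phi> where K: "polyhedral_complex K"
    and bij: "bij_betw \<phi> (nonempty_faces K) {T. covering_forest \<nu> T}"
    and ord: "\<forall>F \<in> nonempty_faces K. \<forall>G \<in> nonempty_faces K. F \<subseteq> G \<longleftrightarrow> \<phi> G \<subseteq> \<phi> F"
    using assms(2) by (auto simp: nu_associahedron_def)
  have dim: "aff_dim F = int i \<longleftrightarrow> card (\<phi> F) + i = length \<nu> + 1" if "F \<in> nonempty_faces K" for F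
    using aff_dim_face[OF \<nu> K bij ord that] by linarith
  have inj: "inj_on \<phi> (nonempty_faces K)" and surj: "\<phi> ` nonempty_faces K = {T. covering_forest \<nu> T}"
    using bij by (auto simp: bij_betw_def)
  have "{F \<in> nonempty_faces K. aff_dim F = int i} =
      {F \<in> nonempty_faces K. card (\<phi> F) + i = length \<nu> + 1}"
    using dim by (intro Collect_cong conj_cong refl)
  then have "card {F \<in> nonempty_faces K. aff_dim F = int i} =
      card {F \<in> nonempty_faces K. card (\<phi> F) + i = length \<nu> + 1}"
    by (rule arg_cong)
  also have "\<dots> = card (\<phi> ` {F \<in> nonempty_faces K. card (\<phi> F) + i = length \<nu> + 1})"
    by (intro card_image[symmetric] inj_on_subset[OF inj]) simp
  also have "\<phi> ` {F \<in> nonempty_faces K. card (\<phi> F) + i = length \<nu> + 1} =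
      {T \<in> \<phi> ` nonempty_faces K. card T + i = length \<nu> + 1}"
    by blast
  also have "{T \<in> \<phi> ` nonempty_faces K. card T + i = length \<nu> + 1} =
      {T. covering_forest \<nu> T \<and> card T + i = length \<nu> + 1}"
    unfolding surj by simp
  also have "card {T. covering_forest \<nu> T \<and> card T + i = length \<nu> + 1} =
      card {\<pi> \<in> schroeder_words 0 \<nu>. length \<pi> + i = length \<nu>}"
  \<comment> \<open>For \<open>i > length \<nu>\<close> the subtraction
    \<open>length \<nu> - i\<close> would be truncated; there both sets are empty, as a covering
    forest has at least one arc.\<close>
  proof (cases "i \<le> length \<nu>")
    case True
    then have "m + i = length \<nu> + 1 \<longleftrightarrow> m = Suc (length \<nu> - i)" "m + i = length \<nu> \<longleftrightarrow> m = length \<nu> - i"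
      for m by auto
    then show ?thesis using card_covering_forests[OF \<nu>, of "length \<nu> - i"] by simp
  next
    case False
    interpret node_sets 1 "num_nodes \<nu>" "I_nodes \<nu>" "J_nodes \<nu>" by (rule node_sets_nodes)
    have "card T > 0" if "covering_forest \<nu> T" for T
    proof -
      have "T \<in> forests 1 (num_nodes \<nu>) (I_nodes \<nu>) (J_nodes \<nu>)"
        using that covering_forest_iff[OF \<nu>] by blast
      then show ?thesis using finite_forest[OF _ fin] forestsD(3) card_gt_0_iff by blast
    qed
    then have "{T. covering_forest \<nu> T \<and> card T + i = length \<nu> + 1} = {}"
      using False by fastforce
    moreover have "{\<pi> \<in> schroeder_words 0 \<nu>. length \<pi> + i = length \<nu>} = {}" using False by auto
    ultimately show ?thesis by (simp only:) simp
  qed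
  also have "\<dots> = sch \<nu> i" using sch_eq_card_words[OF assms(1)] by simp
  finally show "card {F \<in> nonempty_faces K. aff_dim F = int i} = sch \<nu> i" .
qed

end
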